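(* Let $\lambda/\mu$ be a skew shape with $n$ boxes and let $A_{S,T}$ ($S,T\in\mathrm{SYT}(\lambda/\mu)$) be the change-of-basis coefficients defined by $n_T=\sum_{S\in\mathrm{SYT}(\lambda/\mu)}A_{S,T}v_S$, where $\{n_T\}$ and $\{v_T\}$ are the natural and seminormal bases of $\mathbb{S}_n^{\lambda/\mu}$. If $S,T\in\mathrm{SYT}(\lambda/\mu)$, $1\le\ell\le n-1$, and $T'=s_\ell(T)$ is standard, then $$A_{S,T}=\begin{cases}a_\ell(S)\,A_{S,T'}+(1-a_\ell(S))\,A_{S',T'}&\text{if }s_\ell(S)=S'\text{ is standard},\\ a_\ell(S)\,A_{S,T'}&\text{if }s_\ell(S)\text{ is nonstandard}.\end{cases}$$
   Context: A skew shape $\lambda/\mu$ (partitions $\mu\subseteq\lambda$) is the set of boxes in the diagram of $\lambda$ not in that of $\mu$; position $(x,y)$ means row $x$ (counted downward) and column $y$ of $\lambda$. A Young tableau of shape $\lambda/\mu$ ($n$ boxes) is a filling by $1,\dots,n$, each used once; it is standard if entries increase left to right in rows and top to bottom in columns. $\mathrm{SYT}(\lambda/\mu)$ is the set of standard tableaux. A permutation $\sigma\in\mathbb{S}_n$ acts on tableaux by replacing each entry $k$ by $\sigma(k)$; $s_i=(i,i+1)$. The column reading tableau $C$ is the standard tableau obtained by entering $1,\dots,n$ consecutively down the columns, beginning with the southwest-most connected component and filling columns from left to right. For a tableau $T$, $w_T\in\mathbb{S}_n$ is the unique permutation with $w_T(C)=T$. The content of a box $b$ in position $(x,y)$ of $\lambda$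 is $ct(b)=y-x$. For $T\in\mathrm{SYT}(\lambda/\mu)$, let $T(i)$ be the box of $T$ containing $i$ and $a_i(T)=\dfrac{1}{ct(T(i+1))-ct(T(i))}$. $\mathbb{S}_n^{\lambda/\mu}$ is the $\mathbb{C}$-vector space with basis $\{v_T\mid T\in\mathrm{SYT}(\lambda/\mu)\}$ (the seminormal basis), made into a $\mathbb{C}\mathbb{S}_n$-module by $$s_iv_T=a_i(T)v_T+(1+a_i(T))v_{s_i(T)},\qquad v_{s_i(T)}=0\text{ if }s_i(T)\text{ is nonstandard}.$$ The natural basis is $\{n_T\mid T\in\mathrm{SYT}(\lambda/\mu)\}$ with $n_T:=w_Tv_C$. *)

theory Defs
  imports Complex_Main "HOL-Algebra.Group_Action" "HOL-Algebra.Sym_Groups"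
begin

section \<open>Skew shapes and tableaux\<close>

definition is_partition :: "nat list \<Rightarrow> bool" where
  "is_partition lam \<longleftrightarrow> sorted_wrt (\<ge>) lam \<and> (\<forall>r\<in>set lam. 0 < r)"

text \<open>A box is a pair (row, column); rows and columns are counted from 1.\<close>

type_synonym box = "nat \<times> nat"

definition diagram :: "nat list \<Rightarrow> box set" where
  "diagram lam = {(x, y). 1 \<le> x \<and> x \<le> length lam \<and> 1 \<le> y \<and> y \<le> lam ! (x - 1)}"

definition skew_shape :: "nat list \<Rightarrow> nat list \<Rightarrow> bool" where
  "skew_shape lam mu \<longleftrightarrow> is_partition lam \<and> is_partition mu \<and> diagram mu \<subseteq> diagram lam"

definition skew_boxes :: "nat list \<Rightarrow> nat list \<Rightarrow> box set" where
  "skew_boxes lam mu = diagram lam - diagram mu"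

definition content :: "box \<Rightarrow> int" where
  "content b = int (snd b) - int (fst b)"

text \<open>A tableau is a total function that is 0 off its shape, so that two tableaux are equal iff
  they have the same entries.  A permutation of \<open>{1..n}\<close> fixes 0, hence it acts on tableaux
  by composition: \<open>\<sigma> \<circ> T\<close> replaces each entry \<open>k\<close> by \<open>\<sigma> k\<close>.\<close>

type_synonym tableau = "box \<Rightarrow> nat"

definition tableau :: "box set \<Rightarrow> tableau \<Rightarrow> bool" where
  "tableau D T \<longleftrightarrow> bij_betw T D {1..card D} \<and> (\<forall>b. b \<notin> D \<longrightarrow> T b = 0)"

definition standard :: "box set \<Rightarrow> tableau \<Rightarrow> bool" where
  "standard D T \<longleftrightarrow>
     (\<forall>x y y'. (x, y) \<in> D \<and> (x, y') \<in> D \<and> y < y' \<longrightarrow> T (x, y) < T (x, y')) \<and>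
     (\<forall>x x' y. (x, y) \<in> D \<and> (x', y) \<in> D \<and> x < x' \<longrightarrow> T (x, y) < T (x', y))"

definition SYT :: "box set \<Rightarrow> tableau set" where
  "SYT D = {T. tableau D T \<and> standard D T}"

abbreviation adj_transp :: "nat \<Rightarrow> nat \<Rightarrow> nat" where
  "adj_transp i \<equiv> transpose i (i + 1)"

definition box_of :: "box set \<Rightarrow> tableau \<Rightarrow> nat \<Rightarrow> box" where
  "box_of D T i = (THE b. b \<in> D \<and> T b = i)"

text \<open>The reciprocal axial distance; the denominator is nonzero when \<open>T\<close> is standard and
  \<open>1 \<le> i < card D\<close>, since two boxes of equal content never hold consecutive entries.\<close>

definition axial :: "box set \<Rightarrow> nat \<Rightarrow> tableau \<Rightarrow> complex" where
  "axial D i T = 1 / of_int (content (box_of D T (i + 1)) - content (box_of D T i))"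


section \<open>The column reading tableau\<close>

definition adjacent :: "box \<Rightarrow> box \<Rightarrow> bool" where
  "adjacent b c \<longleftrightarrow>
     fst b = fst c \<and> (snd c = snd b + 1 \<or> snd b = snd c + 1) \<or>
     snd b = snd c \<and> (fst c = fst b + 1 \<or> fst b = fst c + 1)"

definition same_component :: "box set \<Rightarrow> box \<Rightarrow> box \<Rightarrow> bool" where
  "same_component D b c \<longleftrightarrow> (b, c) \<in> {(p, q). p \<in> D \<and> q \<in> D \<and> adjacent p q}\<^sup>*"

text \<open>Of two distinct components of a skew shape, one lies strictly south-west of the other, so
  that two boxes of different components can be compared directly.  Within a component the columns
  are read from left to right, each from top to bottom.\<close>

definition read_before :: "box set \<Rightarrow> box \<Rightarrow> box \<Rightarrow> bool" where
  "read_before D b c \<longleftrightarrow>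
     (if same_component D b c
      then snd b < snd c \<or> snd b = snd c \<and> fst b < fst c
      else fst c < fst b \<and> snd b < snd c)"

definition column_reading :: "box set \<Rightarrow> tableau" where
  "column_reading D b = (if b \<in> D then card {c \<in> D. c = b \<or> read_before D c b} else 0)"

definition reading_perm :: "box set \<Rightarrow> tableau \<Rightarrow> nat \<Rightarrow> nat" where
  "reading_perm D T = (THE w. w permutes {1..card D} \<and> w \<circ> column_reading D = T)"


section \<open>The seminormal module and its two bases\<close>

text \<open>A module over the complex group algebra of the symmetric group is the same thing as a
  complex vector space (here the whole type \<^typ>\<open>'v\<close>) with a linear action of the group.  The
  group is generated by the adjacent transpositions, so the last assumption determines the action.\<close>

locale seminormal_module = vector_space scale + group_action "sym_group (card D)" UNIV act
  for scale :: "complex \<Rightarrow> 'v::ab_group_add \<Rightarrow> 'v" (infixr \<open>*s\<close> 75)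
    and D :: "box set"
    and act :: "(nat \<Rightarrow> nat) \<Rightarrow> 'v \<Rightarrow> 'v"
    and v :: "tableau \<Rightarrow> 'v" +
  assumes inj_v: "inj_on v (SYT D)"
    and independent_v: "independent (v ` SYT D)"
    and span_v: "span (v ` SYT D) = UNIV"
    and act_linear: "\<And>\<sigma>. \<sigma> \<in> carrier (sym_group (card D)) \<Longrightarrow> Vector_Spaces.linear scale scale (act \<sigma>)"
    and act_adj_transp:
      "\<And>i T. \<lbrakk>1 \<le> i; i < card D; T \<in> SYT D\<rbrakk> \<Longrightarrow>
         act (adj_transp i) (v T) =
           axial D i T *s v T +
           (1 + axial D i T) *s (if adj_transp i \<circ> T \<in> SYT D then v (adj_transp i \<circ> T) else 0)"

definition natural_vec ::
    "box set \<Rightarrow> ((nat \<Rightarrow> nat) \<Rightarrow> 'v \<Rightarrow> 'v) \<Rightarrow> (tableau \<Rightarrow> 'v) \<Rightarrow> tableau \<Rightarrow> 'v" where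
  "natural_vec D act v T = act (reading_perm D T) (v (column_reading D))"

end

theory Submission
  imports Defs
begin

text \<open>
  Since \<open>T = s\<^sub>l \<circ> T'\<close>, the permutations that carry the column reading tableau \<open>C\<close> to \<open>T\<close> and to
  \<open>T'\<close> satisfy \<open>w\<^sub>T = s\<^sub>l \<circ> w\<^sub>T\<^sub>'\<close>, and hence \<open>n\<^sub>T = s\<^sub>l n\<^sub>T\<^sub>'\<close>.  Expanding \<open>n\<^sub>T\<^sub>'\<close> in the seminormal
  basis and applying the defining formula of \<open>s\<^sub>l\<close>, only \<open>v\<^sub>S\<close> and \<open>v\<^sub>S\<^sub>'\<close> can contribute to the
  coefficient of \<open>v\<^sub>S\<close>.  The first contributes \<open>a\<^sub>l(S)\<close>, the second, if \<open>S'\<close> is standard,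
  \<open>1 + a\<^sub>l(S') = 1 - a\<^sub>l(S)\<close>, because exchanging \<open>l\<close> and \<open>l + 1\<close> reverses the sign of the axial
  distance.

  The permutation \<open>w\<^sub>T\<close> exists only because \<open>C\<close> is a bijective filling, that is, because the
  reading order is a strict total order on the boxes.  This is the geometric part of the proof.
  A skew shape contains, with two boxes weakly north-west and south-east of each other, the whole
  rectangle between them.  So of two boxes in different components, one is strictly
  south-west of the other, which makes the reading order total.  A path of adjacent boxes cannot
  change sides with respect to a box outside its component, which makes the order transitive across
  components.
\<close>

section \<open>Components of a skew shape\<close>

lemma finite_diagram: "finite (diagram lam)"
proof -
  have "diagram lam \<subseteq> {..length lam} \<times> {..Max (set lam)}"
    by (fastforce simp: diagram_def intro: order_trans[OF _ Max_ge])
  then show ?thesis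
    by (rule finite_subset) simp
qed

lemma diagram_downward_closed:
  assumes "is_partition lam" "(x', y') \<in> diagram lam" "1 \<le> x" "x \<le> x'" "1 \<le> y" "y \<le> y'"
  shows "(x, y) \<in> diagram lam"
proof -
  have "lam ! (x' - 1) \<le> lam ! (x - 1)"
  proof (cases "x = x'")
    case False
    have "sorted_wrt (\<ge>) lam" "x' \<le> length lam"
      using assms by (auto simp: is_partition_def diagram_def)
    then show ?thesis
      using sorted_wrt_nth_less[of "(\<ge>)" lam "x - 1" "x' - 1"] False assms(3,4) by simp
  qed simp
  then show ?thesis
    using assms by (auto simp: diagram_def)
qed

lemma skew_boxes_convex:
  assumes "skew_shape lam mu" "(x, y) \<in> skew_boxes lam mu" "(x', y') \<in> skew_boxes lam mu"
    and "x \<le> i" "i \<le> x'" "y \<le> j" "j \<le> y'"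
  shows "(i, j) \<in> skew_boxes lam mu"
proof -
  have pos: "1 \<le> x" "1 \<le> y"
    using assms(2) by (auto simp: skew_boxes_def diagram_def)
  have "(i, j) \<in> diagram lam"
    using assms pos diagram_downward_closed[of lam x' y' i j]
    by (auto simp: skew_shape_def skew_boxes_def)
  moreover have "(i, j) \<notin> diagram mu"
    using assms pos diagram_downward_closed[of mu i j x y]
    by (auto simp: skew_shape_def skew_boxes_def)
  ultimately show ?thesis
    by (simp add: skew_boxes_def)
qed

text \<open>The order on the boxes depends only on this rectangle property, so what follows holds for
  every set of boxes that has it.\<close>

definition rectangle_convex :: "box set \<Rightarrow> bool" where
  "rectangle_convex D \<longleftrightarrow> (\<forall>x y x' y' i j. (x, y) \<in> D \<longrightarrow> (x', y') \<in> D \<longrightarrow>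
     x \<le> i \<longrightarrow> i \<le> x' \<longrightarrow> y \<le> j \<longrightarrow> j \<le> y' \<longrightarrow> (i, j) \<in> D)"

lemma same_component_refl: "same_component D b b"
  by (simp add: same_component_def)

lemma same_component_trans:
  "same_component D b c \<Longrightarrow> same_component D c d \<Longrightarrow> same_component D b d"
  unfolding same_component_def by (rule rtrancl_trans)

lemma same_component_sym:
  assumes "same_component D b c"
  shows "same_component D c b"
proof -
  have "sym {(p, q). p \<in> D \<and> q \<in> D \<and> adjacent p q}"
    by (auto simp: sym_def adjacent_def)
  then show ?thesis
    using assms unfolding same_component_def by (meson sym_rtrancl symD)
qed

lemma same_component_adjacent:
  "p \<in> D \<Longrightarrow> q \<in> D \<Longrightarrow> adjacent p q \<Longrightarrow> same_component D p q"
  by (auto simp: same_component_def)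

text \<open>The rectangle spanned by the two boxes lies in the shape, so its left side followed by its
  bottom side is a path between them.\<close>

lemma comparable_same_component:
  assumes conv: "rectangle_convex D" and D: "(x, y) \<in> D" "(x', y') \<in> D"
    and le: "x \<le> x'" "y \<le> y'"
  shows "same_component D (x, y) (x', y')"
proof -
  have box: "(i, j) \<in> D" if "x \<le> i" "i \<le> x'" "y \<le> j" "j \<le> y'" for i j
    using conv D that unfolding rectangle_convex_def by blast
  have down: "i \<le> x' \<Longrightarrow> same_component D (x, y) (i, y)" if "x \<le> i" for i
    using that
  proof (induction i rule: dec_induct)
    case base
    show ?case by (rule same_component_refl)
  next
    case (step i)
    have "same_component D (i, y) (Suc i, y)"
      using step le by (intro same_component_adjacent box) (auto simp: adjacent_def)
    then show ?case
      using step by (meson Suc_leD same_component_trans)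
  qed
  have right: "j \<le> y' \<Longrightarrow> same_component D (x', y) (x', j)" if "y \<le> j" for j
    using that
  proof (induction j rule: dec_induct)
    case base
    show ?case by (rule same_component_refl)
  next
    case (step j)
    have "same_component D (x', j) (x', Suc j)"
      using step le by (intro same_component_adjacent box) (auto simp: adjacent_def)
    then show ?case
      using step by (meson Suc_leD same_component_trans)
  qed
  show ?thesis
    using down[of x'] right[of y'] le by (blast intro: same_component_trans)
qed

abbreviation strictly_southwest :: "box \<Rightarrow> box \<Rightarrow> bool" where
  "strictly_southwest b c \<equiv> fst c < fst b \<and> snd b < snd c"

lemma different_components_southwest:
  assumes "rectangle_convex D" "b \<in> D" "c \<in> D" "\<not> same_component D b c"
  shows "strictly_southwest b c \<or> strictly_southwest c b"
proof -
  have "\<not> (fst b \<le> fst c \<and> snd b \<le> snd c)"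
    using comparable_same_component[of D "fst b" "snd b" "fst c" "snd c"] assms by auto
  moreover have "\<not> (fst c \<le> fst b \<and> snd c \<le> snd b)"
    using comparable_same_component[of D "fst c" "snd c" "fst b" "snd b"]
      same_component_sym[of D c b] assms by auto
  ultimately show ?thesis
    by linarith
qed

text \<open>Along a path of adjacent boxes that avoids the component of \<open>d\<close>, every box is strictly
  south-west or strictly north-east of \<open>d\<close>.  Passing from one side to the other would change both
  coordinates, but one step changes only one.\<close>

lemma southwest_component_invariant:
  assumes conv: "rectangle_convex D" and "d \<in> D"
    and bc: "same_component D b c" and "\<not> same_component D b d"
  shows "strictly_southwest b d \<longleftrightarrow> strictly_southwest c d"
    and "strictly_southwest d b \<longleftrightarrow> strictly_southwest d c"
proof -
  let ?R = "{(p, q). p \<in> D \<and> q \<in> D \<and> adjacent p q}"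
  have "(b, c) \<in> ?R\<^sup>*"
    using bc by (simp add: same_component_def)
  then have "(strictly_southwest b d \<longleftrightarrow> strictly_southwest c d) \<and>
    (strictly_southwest d b \<longleftrightarrow> strictly_southwest d c)"
  proof (induction rule: rtrancl_induct)
    case base
    show ?case by simp
  next
    case (step p q)
    have pq: "p \<in> D" "q \<in> D" "adjacent p q"
      using step.hyps by auto
    have bp: "same_component D b p"
      using step.hyps by (simp add: same_component_def)
    have "\<not> same_component D p d"
      using bp assms(4) same_component_trans by blast
    then have p: "strictly_southwest p d \<or> strictly_southwest d p"
      using different_components_southwest conv pq assms(2) by blast
    have "\<not> same_component D q d"
      using bp same_component_adjacent[OF pq] assms(4) same_component_trans by blast
    then have q: "strictly_southwest q d \<or> strictly_southwest d q"
      using different_components_southwest conv pq assms(2) by blast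
    have "(strictly_southwest p d \<longleftrightarrow> strictly_southwest q d) \<and>
      (strictly_southwest d p \<longleftrightarrow> strictly_southwest d q)"
      using p q pq(3) unfolding adjacent_def by linarith
    then show ?case
      using step.IH by simp
  qed
  then show "strictly_southwest b d \<longleftrightarrow> strictly_southwest c d"
    and "strictly_southwest d b \<longleftrightarrow> strictly_southwest d c"
    by blast+
qed

section \<open>The reading order and the column reading tableau\<close>

lemma read_before_irrefl: "\<not> read_before D b b"
  by (simp add: read_before_def)

lemma read_before_total:
  assumes "rectangle_convex D" "b \<in> D" "c \<in> D" "b \<noteq> c"
  shows "read_before D b c \<or> read_before D c b"
proof (cases "same_component D b c")
  case True
  then show ?thesis
    using same_component_sym[OF True] assms(4)
    by (auto simp: read_before_def prod_eq_iff)
next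
  case False
  then have "\<not> same_component D c b"
    using same_component_sym by blast
  then show ?thesis
    using False different_components_southwest[OF assms(1-3) False]
    by (auto simp: read_before_def)
qed

text \<open>If exactly two of the three boxes share a component, then the third one lies on the same side
  of both; two strict steps to the north-east therefore never return to the first component.\<close>

lemma read_before_trans:
  assumes conv: "rectangle_convex D" and D: "b \<in> D" "c \<in> D" "d \<in> D"
    and bc: "read_before D b c" and cd: "read_before D c d"
  shows "read_before D b d"
proof (cases "same_component D b c")
  case sbc: True
  show ?thesis
  proof (cases "same_component D c d")
    case True
    then have "same_component D b d"
      using sbc same_component_trans by blast
    then show ?thesis
      using bc cd sbc True by (auto simp: read_before_def)
  next
    case False
    then have nbd: "\<not> same_component D b d"
      using sbc same_component_trans same_component_sym by blast
    have "strictly_southwest c d"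
      using cd False by (simp add: read_before_def)
    then have "strictly_southwest b d"
      using southwest_component_invariant(1)[OF conv D(3) sbc nbd] by simp
    then show ?thesis
      using nbd by (simp add: read_before_def)
  qed
next
  case nbc: False
  then have sw_bc: "strictly_southwest b c"
    using bc by (simp add: read_before_def)
  show ?thesis
  proof (cases "same_component D c d")
    case True
    have ncb: "\<not> same_component D c b"
      using nbc same_component_sym by blast
    then have nbd: "\<not> same_component D b d"
      using True same_component_trans same_component_sym by blast
    have "strictly_southwest b d"
      using southwest_component_invariant(2)[OF conv D(1) True ncb] sw_bc by simp
    then show ?thesis
      using nbd by (simp add: read_before_def)
  next
    case False
    then have sw_cd: "strictly_southwest c d"
      using cd by (simp add: read_before_def)
    have "\<not> same_component D b d"
    proof
      assume "same_component D b d"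
      then have "strictly_southwest d c"
        using southwest_component_invariant(1)[OF conv D(2) _ nbc] sw_bc by blast
      then show False
        using sw_cd by simp
    qed
    then show ?thesis
      using sw_bc sw_cd by (simp add: read_before_def)
  qed
qed

text \<open>The filling counts predecessors in a finite strict total order, so it strictly increases
  along that order.\<close>

lemma column_reading_bij:
  assumes conv: "rectangle_convex D" and fin: "finite D"
  shows "bij_betw (column_reading D) D {1..card D}"
proof -
  define P where "P b = {c \<in> D. c = b \<or> read_before D c b}" for b
  have C: "column_reading D b = card (P b)" if "b \<in> D" for b
    using that by (simp add: column_reading_def P_def)
  have less: "column_reading D b < column_reading D c"
    if bc: "b \<in> D" "c \<in> D" "read_before D b c" for b c
  proof -
    have "c \<notin> P b"
      using bc read_before_trans[OF conv, of b c b] read_before_irrefl unfolding P_def by blast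
    moreover have "P b \<subseteq> P c"
      using bc read_before_trans[OF conv _ bc(1,2) _ bc(3)] unfolding P_def by blast
    moreover have "c \<in> P c"
      using bc by (simp add: P_def)
    ultimately have "P b \<subset> P c"
      by blast
    moreover have "finite (P c)"
      using fin by (simp add: P_def)
    ultimately show ?thesis
      using bc C psubset_card_mono by metis
  qed
  have inj: "inj_on (column_reading D) D"
    by (rule inj_onI) (metis less less_irrefl read_before_total[OF conv])
  have "column_reading D ` D \<subseteq> {1..card D}"
  proof (rule image_subsetI)
    fix b assume b: "b \<in> D"
    have P: "{b} \<subseteq> P b" "P b \<subseteq> D"
      using b by (auto simp: P_def)
    have "card {b} \<le> card (P b)" "card (P b) \<le> card D"
      using P fin by (meson card_mono finite_subset)+
    then show "column_reading D b \<in> {1..card D}"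
      using b C by simp
  qed
  moreover have "card (column_reading D ` D) = card {1..card D}"
    using card_image[OF inj] by simp
  ultimately have "column_reading D ` D = {1..card D}"
    by (intro card_subset_eq) auto
  then show ?thesis
    using inj by (simp add: bij_betw_def)
qed

lemma reading_perm_eqI:
  assumes C: "bij_betw (column_reading D) D {1..card D}"
    and w: "w permutes {1..card D}" "w \<circ> column_reading D = T"
  shows "reading_perm D T = w"
  unfolding reading_perm_def
proof (rule the_equality)
  show "w permutes {1..card D} \<and> w \<circ> column_reading D = T"
    using w by simp
next
  fix u assume u: "u permutes {1..card D} \<and> u \<circ> column_reading D = T"
  show "u = w"
  proof
    fix k
    show "u k = w k"
    proof (cases "k \<in> {1..card D}")
      case True
      then obtain b where "k = column_reading D b"
        using C unfolding bij_betw_def by blast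
      then show ?thesis
        using u w(2) by (metis comp_apply)
    next
      case False
      then show ?thesis
        using u w(1) by (metis permutes_not_in)
    qed
  qed
qed

lemma reading_perm_works:
  assumes C: "bij_betw (column_reading D) D {1..card D}" and T: "tableau D T"
  shows "reading_perm D T permutes {1..card D}" "reading_perm D T \<circ> column_reading D = T"
proof -
  let ?C = "column_reading D"
  define w where "w k = (if k \<in> {1..card D} then T (inv_into D ?C k) else k)" for k
  have "bij_betw (T \<circ> inv_into D ?C) {1..card D} {1..card D}"
    using T bij_betw_trans[OF bij_betw_inv_into[OF C]] unfolding tableau_def by blast
  then have "bij_betw w {1..card D} {1..card D}"
    by (rule bij_betw_cong[THEN iffD1, rotated]) (simp add: w_def)
  then have w: "w permutes {1..card D}"
    by (rule bij_imp_permutes) (auto simp: w_def)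
  have "w (?C b) = T b" for b
  proof (cases "b \<in> D")
    case True
    then have "?C b \<in> {1..card D}" "inv_into D ?C (?C b) = b"
      using C by (auto simp: bij_betw_def)
    then show ?thesis
      by (simp add: w_def)
  next
    case False
    then have "T b = 0"
      using T unfolding tableau_def by blast
    then show ?thesis
      using False by (simp add: w_def column_reading_def)
  qed
  then have wC: "w \<circ> ?C = T"
    by auto
  show "reading_perm D T permutes {1..card D}" "reading_perm D T \<circ> ?C = T"
    using w wC reading_perm_eqI[OF C w wC] by simp_all
qed

lemma reading_perm_comp:
  assumes C: "bij_betw (column_reading D) D {1..card D}" and T: "tableau D T"
    and s: "s permutes {1..card D}"
  shows "reading_perm D (s \<circ> T) = s \<circ> reading_perm D T"
  using reading_perm_works[OF C T] s
  by (intro reading_perm_eqI[OF C]) (auto intro: permutes_compose simp: comp_assoc)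

section \<open>Adjacent transpositions on the seminormal basis\<close>

lemma adj_transp_permutes: "1 \<le> i \<Longrightarrow> i < n \<Longrightarrow> adj_transp i permutes {1..n}"
  by (rule permutes_swap_id) auto

lemma transpose_comp_involutive: "transpose i j \<circ> (transpose i j \<circ> T) = T"
  by (simp add: fun_eq_iff)

lemma axial_adj_transp: "axial D i (adj_transp i \<circ> T) = - axial D i T"
proof -
  have "box_of D (adj_transp i \<circ> T) (i + 1) = box_of D T i"
    and "box_of D (adj_transp i \<circ> T) i = box_of D T (i + 1)"
    unfolding box_of_def by (auto simp: transpose_eq_iff intro!: arg_cong[where f = The])
  then have "axial D i (adj_transp i \<circ> T) =
      1 / of_int (- (content (box_of D T (i + 1)) - content (box_of D T i)))"
    by (simp add: axial_def)
  then show ?thesis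
    by (simp only: axial_def of_int_minus divide_minus_right)
qed

lemma finite_SYT:
  assumes "finite D"
  shows "finite (SYT D)"
proof (rule finite_subset)
  show "SYT D \<subseteq> {T. \<forall>b. (b \<in> D \<longrightarrow> T b \<in> {1..card D}) \<and> (b \<notin> D \<longrightarrow> T b = 0)}"
    by (auto simp: SYT_def tableau_def bij_betw_def)
  show "finite {T. \<forall>b. (b \<in> D \<longrightarrow> T b \<in> {1..card D}) \<and> (b \<notin> D \<longrightarrow> T b = (0::nat))}"
    using assms by (intro finite_set_of_finite_funs) auto
qed

context seminormal_module
begin

lemma act_comp:
  assumes "s permutes {1..card D}" "w permutes {1..card D}"
  shows "act (s \<circ> w) x = act s (act w x)"
  using composition_rule[of x s w] assms by (simp add: sym_group_def)

lemma v_coefficients_unique: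
  assumes fin: "finite (SYT D)" and S: "S \<in> SYT D"
    and eq: "(\<Sum>R\<in>SYT D. f R *s v R) = (\<Sum>R\<in>SYT D. g R *s v R)"
  shows "f S = g S"
proof -
  let ?inv = "inv_into (SYT D) v"
  have "(\<Sum>x\<in>v ` SYT D. (f (?inv x) - g (?inv x)) *s x) =
      (\<Sum>R\<in>SYT D. (f R - g R) *s v R)"
    using inj_v by (simp add: sum.reindex)
  also have "\<dots> = 0"
    using eq by (simp add: scale_left_diff_distrib sum_subtractf)
  finally have "f (?inv (v S)) - g (?inv (v S)) = 0"
    using independent_v fin S
    by (intro independentD[of "v ` SYT D" "v ` SYT D" "\<lambda>x. f (?inv x) - g (?inv x)"]) auto
  then show ?thesis
    using inj_v S by simp
qed

lemma natural_vec_adj_transp: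
  assumes "bij_betw (column_reading D) D {1..card D}" "tableau D T" "1 \<le> i" "i < card D"
  shows "natural_vec D act v (adj_transp i \<circ> T) = act (adj_transp i) (natural_vec D act v T)"
proof -
  have s: "adj_transp i permutes {1..card D}"
    using assms by (intro adj_transp_permutes)
  show ?thesis
    unfolding natural_vec_def reading_perm_comp[OF assms(1,2) s]
    using act_comp[OF s reading_perm_works(1)[OF assms(1,2)]] .
qed

text \<open>The sum over \<open>R\<close> of the terms \<open>v\<^bsub>s\<^sub>i(R)\<^esub>\<close> is reindexed by the involution
  \<open>R \<mapsto> s\<^sub>i(R)\<close> of the standard tableaux that \<open>s\<^sub>i\<close> keeps standard, so that the coefficient of
  each basis vector can be read off.\<close>

lemma act_adj_transp_sum:
  assumes fin: "finite (SYT D)" and i: "1 \<le> i" "i < card D"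
  shows "act (adj_transp i) (\<Sum>R\<in>SYT D. f R *s v R) =
    (\<Sum>R\<in>SYT D. (if adj_transp i \<circ> R \<in> SYT D
       then axial D i R * f R + (1 - axial D i R) * f (adj_transp i \<circ> R)
       else axial D i R * f R) *s v R)"
proof -
  let ?s = "\<lambda>R :: tableau. adj_transp i \<circ> R"
  let ?P = "{R \<in> SYT D. ?s R \<in> SYT D}"
  have "adj_transp i \<in> carrier (sym_group (card D))"
    using adj_transp_permutes i by (simp add: sym_group_def)
  then interpret L: Vector_Spaces.linear scale scale "act (adj_transp i)"
    by (rule act_linear)
  have "act (adj_transp i) (\<Sum>R\<in>SYT D. f R *s v R) =
      (\<Sum>R\<in>SYT D. f R *s act (adj_transp i) (v R))"
    by (simp only: L.sum L.scale)
  also have "\<dots> = (\<Sum>R\<in>SYT D. (f R * axial D i R) *s v R +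
      (if ?s R \<in> SYT D then (f R * (1 + axial D i R)) *s v (?s R) else 0))"
    by (rule sum.cong[OF refl]) (simp add: act_adj_transp[OF i, simplified] scale_right_distrib)
  also have "\<dots> = (\<Sum>R\<in>SYT D. (f R * axial D i R) *s v R) +
      (\<Sum>R\<in>?P. (f R * (1 + axial D i R)) *s v (?s R))"
    by (simp only: sum.distrib sum.inter_filter[OF fin])
  also have "(\<Sum>R\<in>?P. (f R * (1 + axial D i R)) *s v (?s R)) =
      (\<Sum>R\<in>?P. (f (?s R) * (1 - axial D i R)) *s v R)"
    by (rule sum.reindex_bij_witness[of _ ?s ?s])
      (auto simp: transpose_comp_involutive axial_adj_transp[simplified] simp del: comp_apply)
  also have "\<dots> =
      (\<Sum>R\<in>SYT D. if ?s R \<in> SYT D then (f (?s R) * (1 - axial D i R)) *s v R else 0)"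
    by (simp only: sum.inter_filter[OF fin])
  finally show ?thesis
    unfolding sum.distrib[symmetric]
    by (auto intro!: sum.cong simp: scale_left_distrib mult.commute)
qed

end

theorem corollary4p12:
  fixes lam mu :: "nat list"
    and D :: "box set"
    and n l :: nat
    and scale :: "complex \<Rightarrow> 'v::ab_group_add \<Rightarrow> 'v"
    and act :: "(nat \<Rightarrow> nat) \<Rightarrow> 'v \<Rightarrow> 'v"
    and v :: "tableau \<Rightarrow> 'v"
    and A :: "tableau \<Rightarrow> tableau \<Rightarrow> complex"
    and S T S' T' :: tableau
  assumes "skew_shape lam mu"
    and "D = skew_boxes lam mu"
    and "n = card D"
    and "seminormal_module scale D act v"
    and "\<And>U. U \<in> SYT D \<Longrightarrow> natural_vec D act v U = (\<Sum>R\<in>SYT D. scale (A R U) (v R))"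
    and "S \<in> SYT D" and "T \<in> SYT D"
    and "1 \<le> l" and "l \<le> n - 1"
    and "T' = adj_transp l \<circ> T" and "T' \<in> SYT D"
    and "S' = adj_transp l \<circ> S"
  shows "A S T =
    (if S' \<in> SYT D then axial D l S * A S T' + (1 - axial D l S) * A S' T'
     else axial D l S * A S T')"
proof -
  interpret seminormal_module scale D act v
    by (rule assms(4))
  have finD: "finite D"
    using assms(2) by (simp add: skew_boxes_def finite_diagram)
  have "rectangle_convex D"
    unfolding rectangle_convex_def assms(2) using skew_boxes_convex[OF assms(1)] by blast
  then have C: "bij_betw (column_reading D) D {1..card D}"
    using finD by (rule column_reading_bij)
  have fin: "finite (SYT D)"
    using finD by (rule finite_SYT)
  have l: "1 \<le> l" "l < card D"
    using assms(3,8,9) by auto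
  have T: "T = adj_transp l \<circ> T'"
    using assms(10) by (simp add: transpose_comp_involutive del: comp_apply)
  have "tableau D T'"
    using assms(11) by (simp add: SYT_def)
  then have "natural_vec D act v T = act (adj_transp l) (natural_vec D act v T')"
    using natural_vec_adj_transp[OF C _ l] T by metis
  then have "(\<Sum>R\<in>SYT D. scale (A R T) (v R)) =
      act (adj_transp l) (\<Sum>R\<in>SYT D. scale (A R T') (v R))"
    by (simp only: assms(5)[OF assms(7)] assms(5)[OF assms(11)])
  from v_coefficients_unique[OF fin assms(6) this[unfolded act_adj_transp_sum[OF fin l]]]
  show ?thesis
    using assms(12) by simp
qed

end
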